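(* Let $c,d\in\mathbb{Z}$ be such that $d$ is square-free and $256d-27c^4$ is not divisible by the square of any odd prime. If $4\mid(256d-27c^4)$, assume in addition that $(c\bmod 4,d\bmod 4)$ is either $(0,1)$ or $(2,3)$. Suppose $g_{c,d}(x)=x^4+cx^3+d$ is irreducible over $\mathbb{Q}$ and let $\tau$ be a root. Then $\mathbb{Q}(\tau)$ is monogenic and $\mathbb{Z}[\tau]$ is the ring of integers of $\mathbb{Q}(\tau)$.
   Context: A number field $K$ is monogenic if its ring of integers $\mathcal{O}_K$ equals $\mathbb{Z}[\alpha]$ for some $\alpha\in\mathcal{O}_K$. *)

theory Defs
  imports "HOL-Computational_Algebra.Computational_Algebra"
begin

definition is_subfield :: "'a::field set \<Rightarrow> bool" where
  "is_subfield K \<longleftrightarrow> 1 \<in> K \<and> (\<forall>x\<in>K. \<forall>y\<in>K. x - y \<in> K \<and> x * y \<in> K) \<and> (\<forall>x\<in>K. inverse x \<in> K)"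

text \<open>
  Fields of characteristic 0 are viewed as \<open>\<rat>\<close>-vector spaces; the subfield \<open>K\<close> has finite
  degree over \<open>\<rat>\<close> iff it is the \<open>\<rat>\<close>-span of a finite set.
\<close>
definition number_field :: "'a::field_char_0 set \<Rightarrow> bool" where
  "number_field K \<longleftrightarrow>
     is_subfield K \<and> (\<exists>B. finite B \<and> K = module.span (\<lambda>(q::rat) x. of_rat q * x) B)"

definition ring_of_integers :: "'a::field_char_0 set \<Rightarrow> 'a set" where
  "ring_of_integers K = {x \<in> K. algebraic_int x}"

definition rat_adjoin :: "'a::field_char_0 \<Rightarrow> 'a set" where
  "rat_adjoin a = \<Inter>{K. is_subfield K \<and> a \<in> K}"

definition int_adjoin :: "'a::field_char_0 \<Rightarrow> 'a set" where
  "int_adjoin a = range (\<lambda>p::int poly. poly (map_poly of_int p) a)"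

definition monogenic :: "'a::field_char_0 set \<Rightarrow> bool" where
  "monogenic K \<longleftrightarrow>
     number_field K \<and> (\<exists>a\<in>ring_of_integers K. ring_of_integers K = int_adjoin a)"

definition g_poly :: "int \<Rightarrow> int \<Rightarrow> int poly" where
  "g_poly c d = monom 1 4 + monom c 3 + [:d:]"

end

theory Submission
  imports Defs "HOL-Computational_Algebra.Field_as_Ring" "Jordan_Normal_Form.Char_Poly"
begin

text \<open>
  Write \<open>g\<close> for the minimal polynomial of \<open>\<tau>\<close>. If some \<open>f(\<tau>)/p\<close> is integral, then multiplying its
  integral equation by \<open>p\<^sup>n\<close> shows that \<open>f\<close> is nilpotent modulo \<open>(g, p)\<close>, hence divisible modulo \<open>p\<close>
  by every separable factor of \<open>g\<close>. The prime \<open>p\<close> is thus harmless if \<open>g\<close> is separable modulo \<open>p\<close>.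
  Otherwise \<open>g = (x - r)\<^sup>m v + p F\<close> with \<open>v\<close> separable modulo \<open>p\<close> and \<open>p\<close> not dividing \<open>F(r)\<close>, and one argues
  as in Dedekind's criterion: if \<open>f = (x - r)\<^sup>j v q\<close> modulo \<open>p\<close> with \<open>j < m\<close> and \<open>q(r)\<close> prime to \<open>p\<close>,
  then \<open>(\<tau> - r)\<^sup>m\<^sup>-\<^sup>j f(\<tau>)/p\<close> lies in \<open>\<int>[\<tau>]\<close> and is the value at \<open>\<tau>\<close> of a polynomial \<open>e\<close> with \<open>e(r)\<close> prime
  to \<open>p\<close>; integrality makes \<open>\<tau> - r\<close> divide a power of \<open>e(\<tau>)\<close> in \<open>\<int>[\<tau>]\<close>, and evaluating
  at \<open>r\<close> gives a contradiction. For \<open>x\<^sup>4 + c x\<^sup>3 + d\<close>, of discriminant \<open>d\<^sup>2 (256 d - 27 c\<^sup>4)\<close>, such a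
  factorization exists at \<open>r = 0\<close> if \<open>p\<close> divides \<open>d\<close>, at \<open>r = 1\<close> if \<open>p = 2\<close>, and at the double root
  \<open>r = -3c/4\<close> for the remaining ramified primes.
\<close>

section \<open>Integer polynomials modulo a prime\<close>

lemma monic_division:
  fixes f h :: "'b::idom poly"
  assumes "lead_coeff h = 1"
  obtains q r where "f = h * q + r" "r = 0 \<or> degree r < degree h"
proof -
  obtain q r where qr: "pseudo_divmod f h = (q, r)" by fastforce
  have "h \<noteq> 0" using assms by auto
  from pseudo_divmod[OF this qr] assms show ?thesis by (intro that) auto
qed

text \<open>Leading terms divisible by \<open>p\<close> are moved into \<open>[:p:] * s\<close> one
  at a time. The representative \<open>f'\<close> is zero or has the degree of \<open>f\<close>
  modulo \<open>p\<close>, so for prime \<open>p\<close> it can stand in for a polynomial over the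
  field with \<open>p\<close> elements.\<close>

lemma lead_coeff_reduction_mod:
  fixes p :: int and f :: "int poly"
  obtains f' s where "f = f' + [:p:] * s" "f' = 0 \<or> \<not> p dvd lead_coeff f'" "degree f' \<le> degree f"
proof -
  have "\<exists>f' s. f = f' + [:p:] * s \<and> (f' = 0 \<or> \<not> p dvd lead_coeff f') \<and> degree f' \<le> degree f"
  proof (induction "degree f" arbitrary: f rule: less_induct)
    case less
    consider "\<not> p dvd lead_coeff f" | "p dvd lead_coeff f" "degree f = 0" | "p dvd lead_coeff f" "degree f \<noteq> 0"
      by blast
    then show ?case
    proof cases
      case 1
      then show ?thesis by (intro exI[of _ f] exI[of _ 0]) auto
    next
      case 2
      then obtain a where "coeff f 0 = p * a" by auto
      moreover have "f = [:coeff f 0:]" using 2(2) degree_0_id[of f] by metis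
      ultimately have "f = [:p:] * [:a:]" by simp
      then show ?thesis by (intro exI[of _ 0] exI[of _ "[:a:]"]) auto
    next
      case 3
      then obtain a where a: "lead_coeff f = p * a" by auto
      define f1 where "f1 = f - monom (p * a) (degree f)"
      have "degree f1 < degree f"
      proof (cases "f1 = 0")
        case False
        moreover have "degree f1 \<le> degree f"
          unfolding f1_def by (intro degree_diff_le degree_monom_le order_refl)
        ultimately show ?thesis using a by (intro degree_less_if_less_eqI) (auto simp: f1_def)
      qed (use 3 in auto)
      from less[OF this] obtain f' s where fs: "f1 = f' + [:p:] * s"
        "f' = 0 \<or> \<not> p dvd lead_coeff f'" "degree f' \<le> degree f1" by blast
      have "f = f' + [:p:] * (s + monom a (degree f))"
        using fs(1) by (simp add: f1_def algebra_simps smult_monom)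
      with fs \<open>degree f1 < degree f\<close> show ?thesis
        by (intro exI[of _ f'] exI[of _ "s + monom a (degree f)"]) auto
    qed
  qed
  then show ?thesis using that by blast
qed

text \<open>Once \<open>x\<close> is reduced to \<open>x'\<close>, the product \<open>k * x'\<close>
  keeps the leading coefficient of \<open>x'\<close>, which \<open>p\<close> does not divide. As all
  its higher coefficients are multiples of \<open>p\<close>, it is a constant, and so is its monic
  factor \<open>k\<close>.\<close>

lemma monic_dvd_const_mod:
  fixes p N :: int and k :: "int poly"
  assumes k: "lead_coeff k = 1" and eq: "k * x = [:N:] + [:p:] * y" and N: "\<not> p dvd N"
  shows "k = 1"
proof -
  obtain x' s where x: "x = x' + [:p:] * s" "x' = 0 \<or> \<not> p dvd lead_coeff x'"
    by (rule lead_coeff_reduction_mod)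
  have kx: "k * x' = [:N:] + [:p:] * (y - k * s)"
    using eq x(1) by (simp add: algebra_simps)
  have "x' \<noteq> 0"
  proof
    assume "x' = 0"
    then have "coeff ([:N:] + [:p:] * (y - k * s)) 0 = 0" using kx by simp
    then have "N = p * (- coeff (y - k * s) 0)" by (simp add: algebra_simps)
    then show False using N by (metis dvd_triv_left)
  qed
  have "degree (k * x') = 0"
  proof (rule ccontr)
    assume *: "degree (k * x') \<noteq> 0"
    have "lead_coeff x' = coeff (k * x') (degree (k * x'))"
      using k by (simp add: lead_coeff_mult)
    also have "\<dots> = p * coeff (y - k * s) (degree (k * x'))"
      using * unfolding kx by (simp add: coeff_pCons split: nat.split)
    finally show False using x(2) \<open>x' \<noteq> 0\<close> by simp
  qed
  moreover have "k \<noteq> 0" using k by auto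
  ultimately have "degree k = 0" using \<open>x' \<noteq> 0\<close> by (simp add: degree_mult_eq)
  then have "k = [:1:]" using k degree_0_id[of k] by simp
  then show ?thesis by simp
qed

text \<open>Take \<open>h\<close> monic of least degree in the ideal \<open>J\<close> generated by
  \<open>f\<close>, \<open>v\<close> and \<open>p\<close>. Elements of \<open>J\<close> of lower
  degree are multiples of \<open>p\<close>, since otherwise inverting a leading coefficient modulo
  \<open>p\<close> would give a smaller monic element. Hence division by \<open>h\<close> leaves
  remainders that vanish modulo \<open>p\<close>.\<close>

lemma gcd_mod_prime:
  fixes p :: int and f v :: "int poly"
  assumes p: "prime p" and v: "lead_coeff v = 1"
  obtains h k f' s t a b c where "lead_coeff h = 1" "v = h * k + [:p:] * s" "f = h * f' + [:p:] * t"
    "h = f * a + v * b + [:p:] * c" "lead_coeff k = 1"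
proof -
  define J where "J = {f * a + v * b + [:p:] * c | a b c. True}"
  have J_diff: "A - B * q \<in> J" if "A \<in> J" "B \<in> J" for A B q
  proof -
    from that obtain a b c a' b' c' where
      "A = f * a + v * b + [:p:] * c" "B = f * a' + v * b' + [:p:] * c'" by (auto simp: J_def)
    then have "A - B * q = f * (a - a' * q) + v * (b - b' * q) + [:p:] * (c - c' * q)"
      by (simp add: algebra_simps)
    then show ?thesis unfolding J_def by blast
  qed
  have fJ: "f \<in> J" unfolding J_def
    by (rule CollectI, rule exI[of _ 1], rule exI[of _ 0], rule exI[of _ 0]) simp
  have vJ: "v \<in> J" unfolding J_def
    by (rule CollectI, rule exI[of _ 0], rule exI[of _ 1], rule exI[of _ 0]) simp
  have pJ: "[:p:] \<in> J" unfolding J_def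
    by (rule CollectI, rule exI[of _ 0], rule exI[of _ 0], rule exI[of _ 1]) simp
  define h where "h = (ARG_MIN degree h. h \<in> J \<and> lead_coeff h = 1)"
  have h: "h \<in> J" "lead_coeff h = 1"
    and h_min: "\<And>x. x \<in> J \<Longrightarrow> lead_coeff x = 1 \<Longrightarrow> degree h \<le> degree x"
    using arg_min_natI[of "\<lambda>h. h \<in> J \<and> lead_coeff h = 1" v degree]
      arg_min_nat_le[of "\<lambda>h. h \<in> J \<and> lead_coeff h = 1" _ degree] vJ v
    unfolding h_def by auto
  have div: "\<exists>t. r = [:p:] * t" if rJ: "r \<in> J" and r: "r = 0 \<or> degree r < degree h" for r
  proof (cases "r = 0")
    case False
    obtain r' s where r': "r = r' + [:p:] * s" "r' = 0 \<or> \<not> p dvd lead_coeff r'" "degree r' \<le> degree r"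
      by (rule lead_coeff_reduction_mod)
    have "r' = 0"
    proof (rule ccontr)
      assume "r' \<noteq> 0"
      with r' False r have deg: "degree r' < degree h" by simp
      have r'J: "r' \<in> J" using J_diff[OF rJ pJ, of s] r'(1) by simp
      have "coprime p (lead_coeff r')" using p r' \<open>r' \<noteq> 0\<close> by (simp add: prime_imp_coprime)
      then obtain a b where ab: "a * p + b * lead_coeff r' = 1"
        using bezout_int[of p "lead_coeff r'"] by auto
      \<comment> \<open>Scaling by \<open>b\<close> makes the leading coefficient 1 up to a multiple
        of \<open>p\<close>; the monomial, itself in \<open>J\<close>, corrects it to exactly
        1.\<close>
      define r1 where "r1 = [:b:] * r' + monom (a * p) (degree r')"
      have c1: "coeff r1 (degree r') = 1" using ab by (simp add: r1_def)
      have "degree r1 \<le> degree r'" unfolding r1_def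
        by (intro degree_add_le degree_monom_le) simp
      then have d1: "degree r1 = degree r'"
        using le_degree[of r1 "degree r'"] c1 by simp
      have "0 \<in> J" using J_diff[OF pJ pJ, of 1] by simp
      from J_diff[OF J_diff[OF this r'J, of "[:-b:]"] pJ, of "monom (- a) (degree r')"]
      have "r1 \<in> J" by (simp add: r1_def smult_monom minus_monom[symmetric] mult.commute)
      from h_min[OF this] c1 d1 deg show False by simp
    qed
    then show ?thesis using r' by auto
  qed simp
  obtain k r where kr: "v = h * k + r" "r = 0 \<or> degree r < degree h"
    using monic_division[OF h(2)] by blast
  have "r \<in> J" using J_diff[OF vJ h(1), of k] kr by simp
  from div[OF this kr(2)] obtain s where s: "r = [:p:] * s" by blast
  obtain f' r' where fr: "f = h * f' + r'" "r' = 0 \<or> degree r' < degree h"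
    using monic_division[OF h(2)] by blast
  have "r' \<in> J" using J_diff[OF fJ h(1), of f'] fr by simp
  from div[OF this fr(2)] obtain t where t: "r' = [:p:] * t" by blast
  have "degree h \<le> degree v" using h_min vJ v by blast
  have "h * k \<noteq> 0"
  proof
    assume "h * k = 0"
    with kr have "v = r" by simp
    with kr(2) \<open>degree h \<le> degree v\<close> v show False by auto
  qed
  then have "degree h \<le> degree (h * k)" by (intro degree_mult_right_le) auto
  with kr have "lead_coeff v = lead_coeff (h * k)"
    by (cases "r = 0") (auto simp: degree_add_eq_left coeff_eq_0)
  with v h(2) have "lead_coeff k = 1" by (simp add: lead_coeff_mult)
  moreover obtain a b c where "h = f * a + v * b + [:p:] * c" using h(1) unfolding J_def by blast
  ultimately show ?thesis using that h(2) kr(1) fr(1) s t by blast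
qed

text \<open>
  With \<open>h\<close> the gcd of \<open>f\<close> and \<open>v = h k\<close> modulo \<open>p\<close>, nilpotency of \<open>f\<close> puts a power of \<open>h\<close> into \<open>(k, p)\<close>, while
  separability makes \<open>h\<close> and \<open>k\<close> coprime modulo \<open>p\<close>; so \<open>k = 1\<close>.
\<close>
lemma nilpotent_mod_separable:
  fixes p N :: int and f v :: "int poly"
  assumes p: "prime p" and v: "lead_coeff v = 1"
    and sep: "A * v + B * pderiv v = [:N:]" "\<not> p dvd N"
    and f: "f ^ n = v * l + [:p:] * m"
  obtains s t where "f = v * s + [:p:] * t"
proof -
  obtain h k f' s t a b c where h: "lead_coeff h = 1" "v = h * k + [:p:] * s" "f = h * f' + [:p:] * t"
    "h = f * a + v * b + [:p:] * c" "lead_coeff k = 1"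
    by (rule gcd_mod_prime[OF p v, of f])
  have pow: "\<exists>z. (x + y) ^ n = x ^ n + y * z" for x y :: "int poly" and n
  proof (induction n)
    case (Suc n)
    then obtain z where "(x + y) ^ n = x ^ n + y * z" by blast
    then have "(x + y) ^ Suc n = x ^ Suc n + y * (x ^ n + x * z + y * z)" by (simp add: algebra_simps)
    then show ?case by blast
  qed (auto intro: exI[of _ 0])
  obtain z where "(f * a + (v * b + [:p:] * c)) ^ n = (f * a) ^ n + (v * b + [:p:] * c) * z"
    using pow by blast
  then have hn: "h ^ n = f ^ n * a ^ n + (v * b + [:p:] * c) * z"
    using h(4) by (simp add: power_mult_distrib add.assoc)
  \<comment> \<open>Differentiating \<open>v = h k\<close> modulo \<open>p\<close> turns the
    relation between \<open>v\<close> and its derivative into \<open>h U + k W = N\<close> modulo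
    \<open>p\<close>, a Bezout relation for \<open>h\<close> and \<open>k\<close>.\<close>
  define U where "U = A * k + B * pderiv k"
  define W where "W = B * pderiv h"
  define Z where "Z = A * s + B * pderiv s"
  have "pderiv v = pderiv h * k + h * pderiv k + [:p:] * pderiv s"
    unfolding h(2) by (simp add: pderiv_add pderiv_mult pderiv_smult algebra_simps)
  then have N: "[:N:] = h * U + (k * W + [:p:] * Z)"
    unfolding sep(1)[symmetric] using h(2) by (simp add: U_def W_def Z_def algebra_simps)
  obtain z' where z': "[:N:] ^ n = (h * U) ^ n + (k * W + [:p:] * Z) * z'"
    unfolding N using pow by blast
  define P where "P = [:p:]"
  have "[:N:] ^ n = h ^ n * U ^ n + (k * W + P * Z) * z'"
    unfolding P_def z' by (simp add: power_mult_distrib)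
  also have "\<dots> = k * ((h * l * a ^ n + h * b * z) * U ^ n + W * z')
      + P * (((s * l + m) * a ^ n + (s * b + c) * z) * U ^ n + Z * z')"
    unfolding hn f h(2) P_def[symmetric] by (simp add: algebra_simps)
  finally have "[:N ^ n:] = k * ((h * l * a ^ n + h * b * z) * U ^ n + W * z')
      + [:p:] * (((s * l + m) * a ^ n + (s * b + c) * z) * U ^ n + Z * z')"
    unfolding P_def by (simp add: poly_const_pow)
  then have "k * ((h * l * a ^ n + h * b * z) * U ^ n + W * z') = [:N ^ n:]
      + [:p:] * (- (((s * l + m) * a ^ n + (s * b + c) * z) * U ^ n + Z * z'))"
    by (simp add: algebra_simps)
  moreover have "\<not> p dvd N ^ n" using sep(2) p by (meson prime_dvd_power)
  ultimately have "k = 1" using monic_dvd_const_mod[OF h(5)] by blast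
  then have "f = v * f' + [:p:] * (t - s * f')" using h(2,3) by (simp add: algebra_simps)
  then show ?thesis by (rule that)
qed

text \<open>The factor \<open>x - r\<close> is split off as long as the cofactor vanishes at
  \<open>r\<close> modulo \<open>p\<close>, at most \<open>m\<close> times. So \<open>j\<close> is
  the multiplicity of the root \<open>r\<close> modulo \<open>p\<close>, capped at
  \<open>m\<close>.\<close>

lemma linear_power_factor_mod:
  fixes p r :: int and q :: "int poly"
  obtains j q' s where "q = [:- r, 1:] ^ j * q' + [:p:] * s" "j \<le> m" "j < m \<longrightarrow> \<not> p dvd poly q' r"
proof -
  have "\<exists>j q' s. q = [:- r, 1:] ^ j * q' + [:p:] * s \<and> j \<le> m \<and> (j < m \<longrightarrow> \<not> p dvd poly q' r)"
  proof (induction m)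
    case 0
    show ?case by (intro exI[of _ 0] exI[of _ q]) auto
  next
    case (Suc m)
    then obtain j q' s where *: "q = [:- r, 1:] ^ j * q' + [:p:] * s" "j \<le> m" "j < m \<longrightarrow> \<not> p dvd poly q' r"
      by blast
    show ?case
    proof (cases "j = m \<and> p dvd poly q' r")
      case True
      then obtain a where a: "poly q' r = p * a" by auto
      have "[:- r, 1:] dvd q' - [:poly q' r:]" by (subst poly_eq_0_iff_dvd[symmetric]) simp
      then obtain q2 where "q' - [:poly q' r:] = [:- r, 1:] * q2" by blast
      then have "q' = [:- r, 1:] * q2 + [:p:] * [:a:]" using a by (simp add: algebra_simps)
      then have "q = [:- r, 1:] ^ Suc j * q2 + [:p:] * (s + [:- r, 1:] ^ j * [:a:])"
        unfolding *(1) power_Suc by (simp only: algebra_simps)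
      then show ?thesis using True by blast
    next
      case False
      then show ?thesis using * by (metis le_SucI le_neq_implies_less less_Suc_eq_le)
    qed
  qed
  then show ?thesis using that by blast
qed

section \<open>Integral elements of a simple extension\<close>

abbreviation ieval :: "int poly \<Rightarrow> 'a::field_char_0 \<Rightarrow> 'a" where
  "ieval p x \<equiv> poly (map_poly of_int p) x"

abbreviation qeval :: "rat poly \<Rightarrow> 'a::field_char_0 \<Rightarrow> 'a" where
  "qeval p x \<equiv> poly (map_poly of_rat p) x"

interpretation of_rat_poly: map_poly_inj_idom_hom "of_rat :: rat \<Rightarrow> 'b::field_char_0" ..

lemma map_poly_of_rat_of_int:
  "map_poly of_rat (map_poly rat_of_int p) = (map_poly of_int p :: 'b::field_char_0 poly)"
  by (simp add: map_poly_map_poly o_def)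

text \<open>Multiplying the coefficient of index \<open>i\<close> by \<open>k ^ (n - i)\<close>
  scales the roots by \<open>k\<close> and keeps the polynomial monic.\<close>

lemma algebraic_int_of_int_mult:
  fixes x :: "'b::field_char_0"
  assumes "algebraic_int x"
  shows "algebraic_int (of_int k * x)"
proof -
  obtain p where p: "ieval p x = 0" "lead_coeff p = 1"
    using assms unfolding algebraic_int_altdef_ipoly by blast
  define n where "n = degree p"
  define q where "q = (\<Sum>i\<le>n. monom (coeff p i * k ^ (n - i)) i)"
  have cq: "coeff q i = (if i \<le> n then coeff p i * k ^ (n - i) else 0)" for i
    by (simp add: q_def coeff_sum)
  have "degree q \<le> n" by (rule degree_le) (simp add: cq)
  moreover have "coeff q n = 1" using p by (simp add: cq n_def)
  ultimately have "degree q = n" using le_degree[of q n] by simp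
  with \<open>coeff q n = 1\<close> have "lead_coeff q = 1" by simp
  moreover have "ieval q (of_int k * x) = 0"
  proof -
    have "ieval q (of_int k * x) = (\<Sum>i\<le>n. of_int (coeff q i) * (of_int k * x) ^ i)"
      by (simp add: poly_altdef \<open>degree q = n\<close>)
    also have "\<dots> = (\<Sum>i\<le>n. of_int k ^ n * (of_int (coeff p i) * x ^ i))"
      by (rule sum.cong) (auto simp: cq power_mult_distrib power_add[symmetric] mult_ac)
    also have "\<dots> = of_int k ^ n * ieval p x"
      by (simp add: poly_altdef n_def sum_distrib_left)
    finally show ?thesis using p by simp
  qed
  ultimately show ?thesis unfolding algebraic_int_altdef_ipoly by blast
qed

locale monic_root =
  fixes g :: "int poly" and \<tau> :: "'a::field_char_0"
  assumes monic: "lead_coeff g = 1"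
    and irred: "irreducible (map_poly rat_of_int g)"
    and root: "poly (map_poly of_int g) \<tau> = 0"
begin

lemma degree_pos: "degree g > 0"
proof (rule ccontr)
  assume "\<not> degree g > 0"
  then have "g = [:1:]" using monic degree_0_id[of g] by simp
  with root show False by simp
qed

lemma rat_dvd_or_inverse:
  assumes "\<not> map_poly of_int g dvd f"
  obtains u where "qeval u \<tau> * qeval f \<tau> = 1"
proof -
  let ?g = "map_poly rat_of_int g"
  have "coprime ?g f" using irred assms by (intro prime_elem_imp_coprime irreducible_imp_prime_elem_gcd)
  then obtain v u where "v * ?g + u * f = 1"
    using bezout_coefficients_fst_snd[of ?g f] by (metis coprime_iff_gcd_eq_1)
  then have "qeval (v * ?g + u * f) \<tau> = 1" by simp
  then have "qeval u \<tau> * qeval f \<tau> = 1"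
    by (simp add: of_rat_poly.hom_add of_rat_poly.hom_mult map_poly_of_rat_of_int root)
  then show ?thesis by (rule that)
qed

text \<open>As \<open>g\<close> is monic, the division takes place over the integers. A nonzero
  remainder has degree below that of \<open>g\<close>, so its value at \<tau> would be invertible.
  Equations at \<tau> thus become congruences modulo \<open>g\<close> between integer
  polynomials.\<close>

lemma eval_zero_imp_dvd:
  assumes "ieval f \<tau> = 0"
  shows "g dvd f"
proof -
  obtain q r where qr: "f = g * q + r" "r = 0 \<or> degree r < degree g"
    using monic_division[OF monic] by blast
  have "ieval f \<tau> = ieval g \<tau> * ieval q \<tau> + ieval r \<tau>"
    by (simp add: qr(1) of_int_poly_hom.hom_add of_int_poly_hom.hom_mult)
  then have "ieval r \<tau> = 0" using assms root by simp
  then have "qeval (map_poly of_int r) \<tau> = 0" by (simp add: map_poly_of_rat_of_int)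
  then have "map_poly of_int g dvd map_poly rat_of_int r"
    using rat_dvd_or_inverse[of "map_poly of_int r"] by fastforce
  then have "r = 0" using qr(2) by (auto dest!: dvd_imp_degree_le)
  then show ?thesis using qr by simp
qed

text \<open>Clear denominators in a monic equation of \<open>\<beta> = e(\<tau>)/c(\<tau>)\<close>.\<close>
lemma integral_imp_dvd_power:
  assumes "algebraic_int \<beta>" and eq: "ieval c \<tau> * \<beta> = ieval e \<tau>"
  obtains n l m where "e ^ n = c * m + g * l"
proof -
  obtain p where p: "ieval p \<beta> = 0" "lead_coeff p = 1"
    using assms unfolding algebraic_int_altdef_ipoly by blast
  define n where "n = degree p"
  \<comment> \<open>Multiplying the equation of \<beta> by \<open>c(\<tau>)^n\<close> expresses
    \<open>e(\<tau>)^n\<close> by terms containing \<open>c ^ (n - i)\<close> with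
    \<open>i < n\<close>; \<open>m\<close> is their negated sum with one factor \<open>c\<close>
    taken out of each.\<close>
  define m where "m = - (\<Sum>i<n. [:coeff p i:] * e ^ i * c ^ (n - 1 - i))"
  define x where "x = ieval c \<tau>"
  have "ieval m \<tau> = - (\<Sum>i<n. of_int (coeff p i) * ieval e \<tau> ^ i * x ^ (n - 1 - i))"
    by (simp add: m_def x_def of_int_poly_hom.hom_uminus of_int_poly_hom.hom_sum of_int_poly_hom.hom_mult of_int_poly_hom.hom_power poly_sum
        of_int_hom.map_poly_pCons_hom del: mult_pCons_left)
  then have "x * ieval m \<tau> = - (\<Sum>i<n. x * (of_int (coeff p i) * (x * \<beta>) ^ i * x ^ (n - 1 - i)))"
    unfolding eq[symmetric] x_def[symmetric] by (simp add: sum_distrib_left)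
  also have "(\<Sum>i<n. x * (of_int (coeff p i) * (x * \<beta>) ^ i * x ^ (n - 1 - i)))
     = (\<Sum>i<n. x ^ n * (of_int (coeff p i) * \<beta> ^ i))"
  proof (rule sum.cong)
    fix i assume "i \<in> {..<n}"
    then have "x ^ n = x * x ^ i * x ^ (n - 1 - i)"
      by (simp flip: power_Suc power_add)
    then show "x * (of_int (coeff p i) * (x * \<beta>) ^ i * x ^ (n - 1 - i)) = x ^ n * (of_int (coeff p i) * \<beta> ^ i)"
      by (simp add: power_mult_distrib mult_ac)
  qed simp
  also have "\<dots> = x ^ n * (ieval p \<beta> - \<beta> ^ n)"
  proof -
    have "ieval p \<beta> = (\<Sum>i<Suc n. of_int (coeff p i) * \<beta> ^ i)"
      by (simp add: poly_altdef n_def lessThan_Suc_atMost)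
    also have "\<dots> = (\<Sum>i<n. of_int (coeff p i) * \<beta> ^ i) + \<beta> ^ n"
      using p(2) by (simp add: n_def)
    finally show ?thesis by (simp add: sum_distrib_left)
  qed
  finally have "x * ieval m \<tau> = (x * \<beta>) ^ n" using p by (simp add: power_mult_distrib)
  then have "ieval (e ^ n - c * m) \<tau> = 0"
    by (simp add: of_int_poly_hom.hom_minus of_int_poly_hom.hom_mult of_int_poly_hom.hom_power x_def eq)
  then obtain l where "e ^ n - c * m = g * l" using eval_zero_imp_dvd by blast
  then have "e ^ n = c * m + g * l" by (simp add: algebra_simps)
  then show ?thesis by (rule that)
qed

lemma integral_imp_dvd_mod_prime:
  fixes p r N :: int and v F f :: "int poly"
  assumes p: "prime p" and g: "g = [:- r, 1:] ^ m * v + [:p:] * F"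
    and v: "lead_coeff v = 1"
    and sep: "A * v + B * pderiv v = [:N:]" "\<not> p dvd N"
    and F: "m > 0 \<Longrightarrow> \<not> p dvd poly F r"
    and \<beta>: "algebraic_int \<beta>" "of_int p * \<beta> = ieval f \<tau>"
  obtains s t where "f = g * s + [:p:] * t"
proof -
  have p0: "of_int p \<noteq> (0 :: 'a)" using p by auto
  have "ieval [:p:] \<tau> * \<beta> = ieval f \<tau>" using \<beta> by (simp add: of_int_hom.map_poly_pCons_hom)
  from integral_imp_dvd_power[OF \<beta>(1) this] obtain n l k where
    "f ^ n = [:p:] * k + g * l" by blast
  then have "f ^ n = v * ([:- r, 1:] ^ m * l) + [:p:] * (k + F * l)"
    unfolding g by (simp only: algebra_simps)
  from nilpotent_mod_separable[OF p v sep this] obtain q t where q: "f = v * q + [:p:] * t" by blast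
  obtain j q' s where j: "q = [:- r, 1:] ^ j * q' + [:p:] * s" "j \<le> m" "j < m \<longrightarrow> \<not> p dvd poly q' r"
    by (rule linear_power_factor_mod[where q = q and r = r and p = p and m = m])
  have f: "f = [:- r, 1:] ^ j * v * q' + [:p:] * (t + v * s)"
    unfolding q j(1) by (simp only: algebra_simps)
  have "j = m"
  proof (rule ccontr)
    assume "j \<noteq> m"
    with j(2) have "j < m" by simp
    define X where "X = [:- r, 1:] ^ (m - j)"
    have X: "[:- r, 1:] ^ m = X * [:- r, 1:] ^ j" using \<open>j < m\<close> by (simp add: X_def flip: power_add)
    \<comment> \<open>Chosen so that \<open>(\<tau> - r)^(m - j) * \<beta> = e(\<tau>)\<close>:
      replace \<open>[:- r, 1:] ^ m * v\<close> by \<open>g - [:p:] * F\<close> in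
      \<open>X * f\<close> and divide by \<open>p\<close>.\<close>
    define e where "e = X * (t + v * s) - F * q'"
    have "X * f = g * q' + [:p:] * e"
      unfolding e_def f g X by (simp only: algebra_simps)
    then have "ieval (X * f) \<tau> = ieval (g * q' + [:p:] * e) \<tau>" by simp
    then have "ieval X \<tau> * ieval f \<tau> = of_int p * ieval e \<tau>"
      by (simp add: of_int_poly_hom.hom_add of_int_poly_hom.hom_mult root of_int_hom.map_poly_pCons_hom
          del: mult_pCons_left)
    then have "ieval X \<tau> * \<beta> = ieval e \<tau>" using p0 by (simp flip: \<beta>(2))
    from integral_imp_dvd_power[OF \<beta>(1) this] obtain n l k where
      "e ^ n = X * k + g * l" by blast
    \<comment> \<open>At \<open>r\<close> the polynomial \<open>X\<close> vanishes and
      \<open>g\<close> takes the value \<open>p F(r)\<close>, so \<open>p\<close> divides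
      \<open>e(r) = - F(r) q'(r)\<close>.\<close>
    then have "poly (e ^ n) r = poly (X * k + g * l) r" by simp
    then have "poly e r ^ n = p * (poly F r * poly l r)"
      using \<open>j < m\<close> by (simp add: X_def g zero_power)
    then have "p dvd poly e r ^ n" by simp
    then have "p dvd poly e r" using p by (metis prime_dvd_power)
    then have "p dvd poly F r * poly q' r" using \<open>j < m\<close> by (simp add: e_def X_def zero_power)
    then show False using p F j(3) \<open>j < m\<close> by (auto simp: prime_dvd_mult_iff)
  qed
  then have "f = g * q' + [:p:] * (t + v * s - F * q')"
    unfolding f g by (simp add: algebra_simps)
  then show ?thesis by (rule that)
qed

text \<open>Descent on the denominator: if \<open>f = g s + p t\<close> for a prime \<open>p\<close>
  dividing \<open>M\<close>, then \<open>t(\<tau>)\<close> is a numerator for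
  \<open>M / p\<close>.\<close>

lemma integral_quotient_in_int_adjoin:
  assumes step: "\<And>p f \<beta>. prime p \<Longrightarrow> algebraic_int \<beta> \<Longrightarrow> of_int p * \<beta> = ieval f \<tau> \<Longrightarrow>
    \<exists>s t. f = g * s + [:p:] * t"
    and "M > 0" "algebraic_int \<beta>" "of_nat M * \<beta> = ieval f \<tau>"
  shows "\<beta> \<in> int_adjoin \<tau>"
  using assms(2-)
proof (induction M arbitrary: f rule: less_induct)
  case (less M)
  show ?case
  proof (cases "M = 1")
    case True
    then show ?thesis using less.prems unfolding int_adjoin_def by auto
  next
    case False
    then obtain p where p: "prime p" "p dvd M" using prime_factor_nat by blast
    then obtain M' where M: "M = p * M'" by blast
    have "algebraic_int (of_int (int M') * \<beta>)" using less.prems by (intro algebraic_int_of_int_mult)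
    moreover have "of_int (int p) * (of_int (int M') * \<beta>) = ieval f \<tau>"
      using less.prems M by (simp add: mult.assoc)
    ultimately have "\<exists>s t. f = g * s + [:int p:] * t" using p by (intro step) auto
    then obtain s t where st: "f = g * s + [:int p:] * t" by blast
    have "of_nat p * (of_nat M' * \<beta>) = ieval (g * s + [:int p:] * t) \<tau>"
      using less.prems(3) M by (simp add: st mult.assoc del: mult_pCons_left)
    also have "\<dots> = of_nat p * ieval t \<tau>"
      by (simp add: of_int_poly_hom.hom_add of_int_poly_hom.hom_mult root of_int_hom.map_poly_pCons_hom del: mult_pCons_left)
    finally have "of_nat M' * \<beta> = ieval t \<tau>" using p by (auto simp: prime_gt_0_nat)
    moreover have "M' > 0" "M' < M" using M p less.prems(1) by (auto simp: prime_gt_Suc_0_nat intro!: Nat.gr0I)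
    ultimately show ?thesis using less by blast
  qed
qed

end

section \<open>The field generated by \<tau> and its ring of integers\<close>

lemma is_subfield_of_rat:
  fixes K :: "'b::field_char_0 set"
  assumes K: "is_subfield K"
  shows "of_rat q \<in> K"
proof -
  have one: "1 \<in> K" and diff: "\<And>x y. x \<in> K \<Longrightarrow> y \<in> K \<Longrightarrow> x - y \<in> K"
    and mult: "\<And>x y. x \<in> K \<Longrightarrow> y \<in> K \<Longrightarrow> x * y \<in> K"
    and inv: "\<And>x. x \<in> K \<Longrightarrow> inverse x \<in> K"
    using K by (auto simp: is_subfield_def)
  have zero: "0 \<in> K" using diff[OF one one] by simp
  have int: "of_int n \<in> K" for n
  proof (induction n rule: int_induct[where k = 0])
    case (step1 i)
    then have "of_int i - (0 - 1) \<in> K" using diff zero one by blast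
    then show ?case by simp
  next
    case (step2 i)
    then show ?case using diff one by simp
  qed (simp add: zero)
  obtain a b where "q = of_int a / of_int b" by (metis quotient_of_div surj_pair)
  then have "of_rat q = of_int a * inverse (of_int b :: 'b)"
    by (simp add: of_rat_divide divide_inverse of_rat_inverse of_rat_mult)
  then show ?thesis using int inv mult by simp
qed

lemma is_subfield_qeval:
  assumes K: "is_subfield K" and x: "x \<in> K"
  shows "qeval f x \<in> K"
proof (induction f)
  case 0
  show ?case using is_subfield_of_rat[OF K, of 0] by simp
next
  case (pCons a f)
  have "0 - x * qeval f x \<in> K"
    using K x pCons is_subfield_of_rat[OF K, of 0] unfolding is_subfield_def of_rat_0 by blast
  then have "of_rat a - (0 - x * qeval f x) \<in> K"
    using K is_subfield_of_rat[OF K, of a] unfolding is_subfield_def by blast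
  then show ?case by (simp add: of_rat_hom.map_poly_pCons_hom)
qed

lemma clear_denominators:
  fixes f :: "rat poly"
  obtains M :: nat and f' :: "int poly" where "M > 0" "map_poly of_int f' = [:of_nat M:] * f"
proof -
  have "\<exists>(M::nat) f'. M > 0 \<and> map_poly of_int f' = [:of_nat M:] * f"
  proof (induction f)
    case 0
    show ?case by (intro exI[of _ 1] exI[of _ 0]) auto
  next
    case (pCons a f)
    then obtain M :: nat and f' where IH: "M > 0" "map_poly of_int f' = [:of_nat M:] * f" by blast
    obtain b c where "quotient_of a = (b, c)" by fastforce
    then have c: "c > 0" "a = of_int b / of_int c"
      by (auto simp: quotient_of_denom_pos quotient_of_div)
    define k where "k = nat c"
    have k: "k > 0" "rat_of_nat k = of_int c" using c by (auto simp: k_def)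
    have "map_poly of_int (pCons (int M * b) ([:c:] * f')) = [:of_nat (M * k):] * pCons a f"
      using k c IH(2) by (simp add: of_int_hom.map_poly_pCons_hom of_int_hom.map_poly_hom_smult mult.commute)
    then show ?case using IH(1) k(1) by (metis nat_0_less_mult_iff)
  qed
  then show ?thesis using that by blast
qed

lemma is_subfield_rat_adjoin: "is_subfield (rat_adjoin x)"
  unfolding rat_adjoin_def is_subfield_def by auto

context monic_root
begin

text \<open>
  Multiplication by \<open>f(\<tau>)\<close> has an integer matrix in the powers of \<open>\<tau>\<close>, whose characteristic
  polynomial kills \<open>f(\<tau>)\<close>.
\<close>
lemma algebraic_int_ieval: "algebraic_int (ieval f \<tau>)"
proof -
  define n where "n = degree g"
  have n: "n > 0" using degree_pos by (simp add: n_def)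
  \<comment> \<open>The remainder of \<open>x^i f\<close> modulo \<open>g\<close> supplies row
    \<open>i\<close> of the matrix.\<close>
  have "\<exists>r. \<exists>q. [:0, 1:] ^ i * f = g * q + r \<and> degree r < n" for i
    using monic_division[OF monic, of "[:0, 1:] ^ i * f"] degree_pos n_def by (metis degree_0)
  then obtain r where r: "\<And>i. \<exists>q. [:0, 1:] ^ i * f = g * q + r i" "\<And>i. degree (r i) < n"
    by metis
  define M where "M = mat n n (\<lambda>(i, j). coeff (r i) j)"
  have M: "M \<in> carrier_mat n n" by (simp add: M_def)
  define w where "w = vec n (\<lambda>j. \<tau> ^ j)"
  have w: "w \<in> carrier_vec n" by (simp add: w_def)
  have "map_mat of_int M *\<^sub>v w = ieval f \<tau> \<cdot>\<^sub>v w"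
  proof (rule eq_vecI)
    fix i assume "i < dim_vec (ieval f \<tau> \<cdot>\<^sub>v w)"
    then have i: "i < n" by (simp add: w_def)
    obtain q where q: "[:0, 1:] ^ i * f = g * q + r i" using r(1) by blast
    have "(map_mat of_int M *\<^sub>v w) $ i = (\<Sum>j<n. of_int (coeff (r i) j) * \<tau> ^ j)"
      using i by (simp add: M_def w_def scalar_prod_def atLeast0LessThan)
    also have "\<dots> = (\<Sum>j\<le>degree (r i). of_int (coeff (r i) j) * \<tau> ^ j)"
      using r(2)[of i] by (intro sum.mono_neutral_right) (auto simp: coeff_eq_0)
    also have "\<dots> = ieval (r i) \<tau>" by (simp add: poly_altdef)
    also have "\<dots> = ieval (g * q + r i) \<tau>"
      by (simp add: of_int_poly_hom.hom_add of_int_poly_hom.hom_mult root)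
    also have "\<dots> = \<tau> ^ i * ieval f \<tau>"
      unfolding q[symmetric]
      by (simp add: of_int_poly_hom.hom_mult of_int_poly_hom.hom_power of_int_hom.map_poly_pCons_hom)
    finally show "(map_mat of_int M *\<^sub>v w) $ i = (ieval f \<tau> \<cdot>\<^sub>v w) $ i"
      using i by (simp add: w_def)
  qed (simp add: M_def w_def)
  moreover have "w $ 0 = 1" using n by (simp add: w_def)
  then have "w \<noteq> 0\<^sub>v n" using n by auto
  ultimately have "eigenvalue (map_mat of_int M) (ieval f \<tau>)"
    unfolding eigenvalue_def eigenvector_def using w M by auto
  then have "poly (char_poly (map_mat of_int M)) (ieval f \<tau>) = 0"
    using eigenvalue_root_char_poly[of "map_mat of_int M :: 'a mat" n] M by auto
  then have "ieval (char_poly M) (ieval f \<tau>) = 0"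
    by (simp add: of_int_hom.char_poly_hom[OF M])
  moreover have "lead_coeff (char_poly M) = 1" using degree_monic_char_poly[OF M] by simp
  ultimately show ?thesis unfolding algebraic_int_altdef_ipoly by blast
qed

text \<open>Rational polynomials in \<tau> already form a field: a Bezout relation with the
  irreducible \<open>g\<close> yields inverses.\<close>

lemma rat_adjoin_eq: "rat_adjoin \<tau> = range (\<lambda>f. qeval f \<tau>)"
proof
  let ?S = "range (\<lambda>f. qeval f \<tau>)"
  have "inverse x \<in> ?S" if "x \<in> ?S" for x
  proof -
    from that obtain f where f: "x = qeval f \<tau>" by blast
    show ?thesis
    proof (cases "map_poly of_int g dvd f")
      case True
      then obtain q where "f = map_poly of_int g * q" by blast
      then have "x = 0" by (simp add: f of_rat_poly.hom_mult map_poly_of_rat_of_int root)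
      then show ?thesis by (auto intro!: range_eqI[of _ _ 0])
    next
      case False
      then obtain u where "qeval u \<tau> * qeval f \<tau> = 1" by (rule rat_dvd_or_inverse)
      then have "inverse x = qeval u \<tau>" unfolding f by (metis inverse_unique mult.commute)
      then show ?thesis by blast
    qed
  qed
  moreover have "1 \<in> ?S" by (rule range_eqI[of _ _ 1]) simp
  moreover have "qeval f \<tau> - qeval h \<tau> \<in> ?S" "qeval f \<tau> * qeval h \<tau> \<in> ?S" for f h
    by (auto intro: range_eqI[of _ _ "f - h"] range_eqI[of _ _ "f * h"]
        simp: of_rat_poly.hom_minus of_rat_poly.hom_mult)
  ultimately have "is_subfield ?S" unfolding is_subfield_def by auto
  moreover have "\<tau> \<in> ?S"
    by (rule range_eqI[of _ _ "[:0, 1:]"]) (simp add: of_rat_hom.map_poly_pCons_hom)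
  ultimately show "rat_adjoin \<tau> \<subseteq> ?S" unfolding rat_adjoin_def by blast
  show "?S \<subseteq> rat_adjoin \<tau>" unfolding rat_adjoin_def using is_subfield_qeval by blast
qed

lemma number_field_rat_adjoin: "number_field (rat_adjoin \<tau>)"
proof -
  interpret Q: Modules.module "\<lambda>(q::rat) (x::'a). of_rat q * x"
    by unfold_locales (simp_all add: algebra_simps of_rat_add of_rat_mult)
  define B where "B = (\<lambda>i. \<tau> ^ i) ` {..<degree g}"
  have "qeval f \<tau> \<in> Q.span B" for f
  proof -
    let ?g = "map_poly rat_of_int g"
    define r where "r = f mod ?g"
    have "f = ?g * (f div ?g) + r" by (simp add: r_def)
    then have "qeval f \<tau> = qeval (?g * (f div ?g) + r) \<tau>" by simp
    also have "\<dots> = qeval r \<tau>"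
      by (simp add: of_rat_poly.hom_add of_rat_poly.hom_mult map_poly_of_rat_of_int root)
    also have "\<dots> = (\<Sum>i\<le>degree r. of_rat (coeff r i) * \<tau> ^ i)" by (simp add: poly_altdef)
    also have "\<dots> \<in> Q.span B"
    proof (intro Q.span_sum Q.span_scale Q.span_base)
      fix i assume "i \<in> {..degree r}"
      moreover have "degree r < degree g"
        using degree_mod_less[of ?g f] degree_pos by (cases "r = 0"; cases "g = 0") (auto simp: r_def)
      ultimately show "\<tau> ^ i \<in> B" by (auto simp: B_def)
    qed
    finally show ?thesis .
  qed
  moreover have "Q.span B \<subseteq> range (\<lambda>f. qeval f \<tau>)"
  proof (rule Q.span_minimal)
    have "\<tau> ^ i \<in> range (\<lambda>f. qeval f \<tau>)" for i
      by (rule range_eqI[of _ _ "[:0, 1:] ^ i"])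
        (simp add: of_rat_poly.hom_power of_rat_hom.map_poly_pCons_hom)
    then show "B \<subseteq> range (\<lambda>f. qeval f \<tau>)" by (auto simp: B_def)
    have "qeval f \<tau> + qeval h \<tau> \<in> range (\<lambda>f. qeval f \<tau>)" for f h
      by (rule range_eqI[of _ _ "f + h"]) (simp add: of_rat_poly.hom_add)
    moreover have "of_rat q * qeval f \<tau> \<in> range (\<lambda>f. qeval f \<tau>)" for q f
      by (rule range_eqI[of _ _ "[:q:] * f"])
        (simp add: of_rat_hom.map_poly_hom_smult)
    ultimately show "Q.subspace (range (\<lambda>f. qeval f \<tau>))"
      unfolding Q.subspace_def by (auto intro: range_eqI[of _ _ 0])
  qed
  ultimately have "rat_adjoin \<tau> = Q.span B" unfolding rat_adjoin_eq by blast
  moreover have "finite B" by (simp add: B_def)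
  ultimately show ?thesis
    unfolding number_field_def using is_subfield_rat_adjoin by blast
qed

lemma ring_of_integers_eq_int_adjoin:
  assumes step: "\<And>p f \<beta>. prime p \<Longrightarrow> algebraic_int \<beta> \<Longrightarrow> of_int p * \<beta> = ieval f \<tau> \<Longrightarrow>
    \<exists>s t. f = g * s + [:p:] * t"
  shows "ring_of_integers (rat_adjoin \<tau>) = int_adjoin \<tau>"
proof
  show "int_adjoin \<tau> \<subseteq> ring_of_integers (rat_adjoin \<tau>)"
    unfolding int_adjoin_def ring_of_integers_def rat_adjoin_eq
    by (auto simp: algebraic_int_ieval intro!: range_eqI[of _ _ "map_poly of_int _"]
        map_poly_of_rat_of_int[symmetric, THEN arg_cong[where f = "\<lambda>f. poly f \<tau>"]])
  show "ring_of_integers (rat_adjoin \<tau>) \<subseteq> int_adjoin \<tau>"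
  proof
    fix x assume "x \<in> ring_of_integers (rat_adjoin \<tau>)"
    then obtain f where f: "x = qeval f \<tau>" and x: "algebraic_int x"
      unfolding ring_of_integers_def rat_adjoin_eq by blast
    obtain M f' where M: "M > 0" "map_poly of_int f' = [:of_nat M:] * f" by (rule clear_denominators)
    have "of_nat M * x = qeval ([:of_nat M:] * f) \<tau>"
      by (simp add: f of_rat_hom.map_poly_hom_smult)
    also have "\<dots> = ieval f' \<tau>" unfolding M(2)[symmetric] map_poly_of_rat_of_int ..
    finally show "x \<in> int_adjoin \<tau>"
      by (intro integral_quotient_in_int_adjoin[OF _ M(1) x] step)
  qed
qed

end

section \<open>The quartic\<close>

lemma g_poly_eq: "g_poly c d = [:d, 0, 0, c, 1:]"
  by (simp add: g_poly_def monom_altdef numeral_eq_Suc)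

context
  fixes c d :: int and \<tau> :: "'a::field_char_0"
  assumes root: "monic_root (g_poly c d) \<tau>"
begin

interpretation monic_root "g_poly c d" \<tau> by (rule root)

text \<open>Modulo \<open>p\<close> the quartic is \<open>x^4\<close> or \<open>x^3 (x + c)\<close>.
  In both cases \<open>F(0) = d / p\<close>, which is prime to \<open>p\<close> because
  \<open>p^2\<close> does not divide \<open>d\<close>.\<close>

lemma quartic_step_dvd_const:
  assumes p: "prime p" and d: "p dvd d" "\<not> p ^ 2 dvd d"
    and \<beta>: "algebraic_int \<beta>" "of_int p * \<beta> = ieval f \<tau>"
  shows "\<exists>s t. f = g_poly c d * s + [:p:] * t"
proof -
  obtain d' where d': "d = p * d'" using d by blast
  have nd: "\<not> p dvd d'" using d(2) by (auto simp: d' power2_eq_square)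
  have np: "\<not> p dvd 1" using p by (metis not_prime_unit)
  show ?thesis
  proof (cases "p dvd c")
    case True
    then obtain c' where c': "c = p * c'" by blast
    have g: "g_poly c d = [:- 0, 1:] ^ 4 * 1 + [:p:] * [:d', 0, 0, c':]"
      by (simp add: g_poly_eq d' c' numeral_eq_Suc)
    have sep: "1 * 1 + 0 * pderiv 1 = [:1 :: int:]" by simp
    show ?thesis
      by (rule integral_imp_dvd_mod_prime[OF p g _ sep np _ \<beta>]) (use nd in auto)
  next
    case False
    have g: "g_poly c d = [:- 0, 1:] ^ 3 * [:c, 1:] + [:p:] * [:d':]"
      by (simp add: g_poly_eq d' numeral_eq_Suc)
    have sep: "0 * [:c, 1:] + 1 * pderiv [:c, 1:] = [:1 :: int:]" by (simp add: pderiv_pCons)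
    show ?thesis
      by (rule integral_imp_dvd_mod_prime[OF p g _ sep np _ \<beta>]) (use nd in auto)
  qed
qed

text \<open>Here \<open>g\<close> is \<open>(x - 1)^4\<close> modulo 2, and
  \<open>F(1) = g(1) / 2 = (1 + c + d) / 2\<close> is odd for both residue pairs.\<close>

lemma quartic_step_two:
  assumes cd: "(c mod 4, d mod 4) \<in> {(0, 1), (2, 3)}"
    and \<beta>: "algebraic_int \<beta>" "of_int 2 * \<beta> = ieval f \<tau>"
  shows "\<exists>s t. f = g_poly c d * s + [:2:] * t"
proof -
  obtain c' d' where c': "c = 2 * c'" and d': "d = 2 * d' + 1" and odd: "odd (c' + d' + 1)"
  proof (rule that)
    show "c = 2 * (c div 2)" "d = 2 * (d div 2) + 1" "odd (c div 2 + d div 2 + 1)"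
      using cd by (auto, presburger+)
  qed
  have g: "g_poly c d = [:- 1, 1:] ^ 4 * 1 + [:2:] * [:d', 2, -3, c' + 2:]"
    by (simp add: g_poly_eq d' c' numeral_eq_Suc)
  have sep: "1 * 1 + 0 * pderiv 1 = [:1 :: int:]" by simp
  show ?thesis
    by (rule integral_imp_dvd_mod_prime[OF _ g _ sep _ _ \<beta>]) (use odd in auto)
qed

text \<open>The derivative is \<open>x^2 (4 x + 3 c)\<close> and 0 is not a root modulo
  \<open>p\<close>, so a multiple root must solve \<open>4 x + 3 c = 0\<close> modulo
  \<open>p\<close>.\<close>

lemma quartic_step_ramified:
  assumes p: "prime p" "odd p" and pd: "\<not> p dvd d"
    and D: "p dvd 256 * d - 27 * c ^ 4" "\<not> p ^ 2 dvd 256 * d - 27 * c ^ 4"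
    and \<beta>: "algebraic_int \<beta>" "of_int p * \<beta> = ieval f \<tau>"
  shows "\<exists>s t. f = g_poly c d * s + [:p:] * t"
proof -
  have "coprime p 2" using p by (simp add: coprime_right_2_iff_odd)
  then have cop: "coprime (p ^ i) (2 ^ k)" for i k by simp
  have pc: "\<not> p dvd c"
  proof
    assume "p dvd c"
    then have "p dvd 256 * d - 27 * c ^ 4 + 27 * c ^ 4"
      by (intro dvd_add D(1) dvd_mult) (metis dvd_power dvd_trans zero_less_numeral)
    then have "p dvd 2 ^ 8 * d" by simp
    then show False using pd cop[of 1 8] by (simp add: coprime_dvd_mult_right_iff)
  qed
  \<comment> \<open>\<open>b\<close> inverts 4 modulo \<open>p^2\<close>. Solving
    \<open>4 r + 3 c = 0\<close> modulo \<open>p^2\<close> instead of \<open>p\<close> makes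
    \<open>256 g(r)\<close> congruent to \<open>256 d - 27 c^4\<close> modulo \<open>p^2\<close>, so
    \<open>p\<close> divides \<open>g(r)\<close> exactly once.\<close>
  obtain a b where ab: "a * p ^ 2 + b * 4 = 1" using cop[of 2 2] bezout_int[of "p ^ 2" 4] by auto
  define r where "r = - 3 * c * b"
  define u where "u = 3 * c * a"
  have "4 * r + 3 * c = 3 * c * (1 - b * 4)" by (simp add: r_def algebra_simps)
  also have "1 - b * 4 = a * p ^ 2" using ab by simp
  finally have r: "4 * r + 3 * c = p ^ 2 * u" by (simp add: u_def)
  define G where "G = r ^ 4 + c * r ^ 3 + d"
  \<comment> \<open>\<open>256 g(x)\<close> is a monic quartic in \<open>4 x\<close> with remainder \<open>256 d - 27 c\<^sup>4\<close> at \<open>4 x = - 3 c\<close>; \<open>K\<close> is the quotient.\<close>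
  define K where "K = (4 * r) ^ 3 + c * (4 * r) ^ 2 - 3 * c ^ 2 * (4 * r) + 9 * c ^ 3"
  have "256 * G = (4 * r + 3 * c) * K + (256 * d - 27 * c ^ 4)"
    unfolding G_def K_def by (simp add: power2_eq_square power3_eq_cube power4_eq_xxxx algebra_simps)
  then have G: "2 ^ 8 * G = p ^ 2 * (u * K) + (256 * d - 27 * c ^ 4)" by (simp add: r)
  have "p dvd 2 ^ 8 * G" unfolding G using D(1) by (intro dvd_add) (auto simp: power2_eq_square)
  then have "p dvd G" using cop[of 1 8] by (simp add: coprime_dvd_mult_right_iff)
  then obtain w where w: "G = p * w" by blast
  have pw: "\<not> p dvd w"
  proof
    assume "p dvd w"
    then have "p ^ 2 dvd 2 ^ 8 * G - p ^ 2 * (u * K)" by (auto simp: w power2_eq_square)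
    also have "2 ^ 8 * G - p ^ 2 * (u * K) = 256 * d - 27 * c ^ 4" using G by linarith
    finally show False using D(2) by contradiction
  qed
  \<comment> \<open>Division of \<open>g\<close> by \<open>(x - r)\<^sup>2\<close> leaves the remainder \<open>g'(r) (x - r) + g(r) = p F\<close>.\<close>
  define v where "v = [:3 * r ^ 2 + 2 * r * c, 2 * r + c, 1:]"
  define F where "F = [:w - r * (p * u * r ^ 2), p * u * r ^ 2:]"
  have c_eq: "r ^ 2 * (4 * r + 3 * c) = p * (p * u * r ^ 2)" unfolding r by (simp add: power2_eq_square)
  have d_eq: "r ^ 4 + c * r ^ 3 + d = p * w" using w G_def by simp
  have g: "g_poly c d = [:- r, 1:] ^ 2 * v + [:p:] * F"
  proof -
    have "[:- r, 1:] ^ 2 * v = [:r ^ 2 * (3 * r ^ 2 + 2 * r * c), - (r ^ 2 * (4 * r + 3 * c)), 0, c, 1:]"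
      by (simp add: v_def power2_eq_square algebra_simps)
    moreover have "[:p:] * F = [:p * w - r * (p * (p * u * r ^ 2)), p * (p * u * r ^ 2):]"
      by (simp add: F_def algebra_simps)
    moreover have "d = r ^ 2 * (3 * r ^ 2 + 2 * r * c) + (p * w - r * (p * (p * u * r ^ 2)))"
      unfolding c_eq[symmetric] d_eq[symmetric] by (simp add: power2_eq_square power3_eq_cube power4_eq_xxxx algebra_simps)
    ultimately show ?thesis using c_eq by (simp add: g_poly_eq)
  qed
  \<comment> \<open>This is minus the discriminant of the quadratic \<open>v\<close>, written as
    \<open>4 v\<close> minus the square of the derivative.\<close>
  define N where "N = 8 * r ^ 2 + 4 * r * c - c ^ 2"
  have sep: "[:4:] * v + [:- (2 * r + c), - 2:] * pderiv v = [:N:]"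
    by (simp add: v_def N_def pderiv_pCons power2_eq_square algebra_simps)
  have pN: "\<not> p dvd N"
  proof
    assume "p dvd N"
    \<comment> \<open>The identity behind this is
      \<open>2 N = (4 r + 3 c) (4 r - c) + c^2\<close>.\<close>
    then have "p dvd 2 * N - p ^ 2 * (u * (4 * r - c))" by (simp add: power2_eq_square)
    also have "2 * N - p ^ 2 * (u * (4 * r - c)) = c ^ 2"
      unfolding mult.assoc[symmetric] r[symmetric] N_def
      by (simp add: power2_eq_square algebra_simps)
    finally show False using pc p(1) by (simp add: prime_dvd_power_iff)
  qed
  have "poly F r = w" by (simp add: F_def)
  show ?thesis
    by (rule integral_imp_dvd_mod_prime[OF p(1) g _ sep pN _ \<beta>]) (use pw \<open>poly F r = w\<close> in \<open>auto simp: v_def\<close>)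
qed

text \<open>Multiply \<open>d = g - X L\<close> by \<open>D = 256 g - (4 x + 3 c) K\<close>. The
  only term without a factor \<open>g\<close> is \<open>X L (4 x + 3 c) K\<close>, a multiple of the
  derivative \<open>X (4 x + 3 c)\<close>; so \<open>d D\<close> is a combination of
  \<open>g\<close> and its derivative.\<close>

lemma quartic_step_unramified:
  assumes p: "prime p" and pd: "\<not> p dvd d" "\<not> p dvd 256 * d - 27 * c ^ 4"
    and \<beta>: "algebraic_int \<beta>" "of_int p * \<beta> = ieval f \<tau>"
  shows "\<exists>s t. f = g_poly c d * s + [:p:] * t"
proof -
  define D where "D = 256 * d - 27 * c ^ 4"
  define L where "L = [:0, c, 1:]"
  define K where "K = [:9 * c ^ 3, - 12 * c ^ 2, 16 * c, 64:]"
  define X where "X = [:0, 0, 1 :: int:]"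
  define g where "g = g_poly c d"
  have g': "pderiv g = X * [:3 * c, 4:]"
    by (simp add: g_def g_poly_eq X_def pderiv_pCons)
  have 1: "[:256:] * g = [:3 * c, 4:] * K + [:D:]"
    by (simp add: g_def g_poly_eq K_def D_def power2_eq_square power3_eq_cube power4_eq_xxxx algebra_simps)
  have 2: "g = X * L + [:d:]"
    by (simp add: g_def g_poly_eq X_def L_def)
  have 3: "[:d * D:] = [:d:] * [:D:]" by simp
  have sep: "([:D:] - [:256:] * X * L) * g + (L * K) * pderiv g = [:d * D:]"
  proof -
    have "[:D:] = [:256:] * g - [:3 * c, 4:] * K" using 1 by (simp add: algebra_simps)
    moreover have "[:d:] = g - X * L" using 2 by (simp add: algebra_simps)
    moreover have "(C * g - Y * K - C * X * L) * g + L * K * (X * Y) = (g - X * L) * (C * g - Y * K)"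
      for C Y by (simp add: algebra_simps)
    ultimately show ?thesis unfolding g' 3 by (simp only:)
  qed
  have N: "\<not> p dvd d * D" using pd p by (auto simp: D_def prime_dvd_mult_iff)
  \<comment> \<open>Since \<open>g\<close> itself is separable modulo \<open>p\<close>, the linear
    factor gets exponent 0.\<close>
  have eq: "g_poly c d = [:- 0, 1:] ^ 0 * g + [:p:] * 0" by (simp add: g_def)
  have "lead_coeff g = 1" unfolding g_def by (rule monic)
  show ?thesis
    by (rule integral_imp_dvd_mod_prime[OF p eq \<open>lead_coeff g = 1\<close> sep N _ \<beta>]) auto
qed

end

theorem theorem3p2:
  fixes c d :: int and \<tau> :: "'a::field_char_0"
  assumes "squarefree d"
    and "\<And>p::int. prime p \<Longrightarrow> odd p \<Longrightarrow> \<not> p ^ 2 dvd 256 * d - 27 * c ^ 4"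
    and "4 dvd 256 * d - 27 * c ^ 4 \<Longrightarrow> (c mod 4, d mod 4) \<in> {(0, 1), (2, 3)}"
    and "irreducible (map_poly rat_of_int (g_poly c d))"
    and "poly (map_poly of_int (g_poly c d)) \<tau> = 0"
  shows "monogenic (rat_adjoin \<tau>) \<and> ring_of_integers (rat_adjoin \<tau>) = int_adjoin \<tau>"
proof -
  interpret monic_root "g_poly c d" \<tau>
    using assms(4,5) by unfold_locales (simp_all add: g_poly_eq)
  note root = monic_root_axioms
  have "\<exists>s t. f = g_poly c d * s + [:p:] * t"
    if p: "prime p" and \<beta>: "algebraic_int \<beta>" "of_int p * \<beta> = ieval f \<tau>" for p f \<beta>
  proof -
    consider "p dvd d" | "\<not> p dvd d" "p dvd 256 * d - 27 * c ^ 4" "odd p"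
      | "\<not> p dvd d" "p dvd 256 * d - 27 * c ^ 4" "even p"
      | "\<not> p dvd d" "\<not> p dvd 256 * d - 27 * c ^ 4" by blast
    then show ?thesis
    proof cases
      case 1
      moreover have "\<not> p ^ 2 dvd d" using assms(1) p unfolding squarefree_def by (meson not_prime_unit)
      ultimately show ?thesis using quartic_step_dvd_const[OF root p _ _ \<beta>] by blast
    next
      case 2
      then show ?thesis using quartic_step_ramified[OF root p _ _ _ _ \<beta>] assms(2)[OF p] by blast
    next
      case 3
      have "p = 2" using p 3 by (metis prime_odd_int prime_ge_2_int order_le_less)
      \<comment> \<open>Evenness of \<open>c\<close> makes \<open>256 d - 27 c^4\<close> divisible
        by 4, which brings in the residue condition.\<close>
      with 3 have "even c" by simp
      then obtain c' where "c = 2 * c'" by blast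
      then have "256 * d - 27 * c ^ 4 = 4 * (64 * d - 108 * c' ^ 4)" by (simp add: power_mult_distrib)
      then have "4 dvd 256 * d - 27 * c ^ 4" by simp
      then show ?thesis using quartic_step_two[OF root assms(3)] \<beta> \<open>p = 2\<close> by blast
    next
      case 4
      then show ?thesis using quartic_step_unramified[OF root p _ _ \<beta>] by blast
    qed
  qed
  then have *: "ring_of_integers (rat_adjoin \<tau>) = int_adjoin \<tau>"
    by (rule ring_of_integers_eq_int_adjoin)
  moreover have "\<tau> \<in> int_adjoin \<tau>"
    unfolding int_adjoin_def by (rule range_eqI[of _ _ "[:0, 1:]"]) (simp add: of_int_hom.map_poly_pCons_hom)
  ultimately show ?thesis using number_field_rat_adjoin unfolding monogenic_def by blast
qed

end
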